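(* Let $k\ge 1$, let $u=\prod_{i=1}^k x_i^{m_i}$ be a vertex of $\mathcal{SY}_k$ and let $n:=\sum_{i=1}^k m_i$. Then the number of directed paths in $\mathcal{SY}_k$ from the origin $1=x_1^0\cdots x_k^0$ to $u$ equals $$P_{\mathcal{SY}_k}(1,u)=\prod_{1\le i<j\le k}\frac{m_i-m_j}{m_i+m_j}\cdot\frac{n!}{\prod_{i=1}^k m_i!},$$ where the factor $\frac{m_i-m_j}{m_i+m_j}$ is understood to be $1$ when $m_i=m_j=0$.
   Context: The lattice $\mathbb{Z}^k$ is regarded as a directed graph: a vector $(c_1,\dots,c_k)\in\mathbb{Z}^k$ is identified with the Laurent monomial $x_1^{c_1}\cdots x_k^{c_k}$, and there is a directed edge from $w$ to $x_iw$ for every monomial $w$ and every $i\in\{1,\dots,k\}$ (i.e. edges increase one coordinate by 1). The graph of strict partitions $\mathcal{SY}_k$ is the induced subgraph of $\mathbb{Z}^k$ on the vectors $(c_1,\dots,c_k)$ of non-negative integers with $c_1\ge c_2\ge\dots\ge c_k\ge 0$ such that $c_i=c_j$ with $i\ne j$ implies $c_i=0$. For vertices $v,u$ of a graph $G$, $P_G(v,u)$ is the number of directed paths in $G$ from $v$ to $u$. *)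

theory Defs
  imports Complex_Main "HOL-Library.FuncSet" "Graph_Theory.Digraph_Component" "Graph_Theory.Arc_Walk"
begin

text \<open>
  A Laurent monomial in k variables is represented by its exponent vector, an extensional function
  on the index set {1..k}. Multiplication by the i-th variable adds 1 to the i-th exponent.
\<close>

type_synonym vec = "nat \<Rightarrow> int"

definition lattice :: "nat \<Rightarrow> vec set" where
  "lattice k = {1..k} \<rightarrow>\<^sub>E UNIV"

definition origin :: "nat \<Rightarrow> vec" where
  "origin k = (\<lambda>i\<in>{1..k}. 0)"

definition mult_var :: "nat \<Rightarrow> vec \<Rightarrow> vec" where
  "mult_var i w = w(i := w i + 1)"

definition lattice_graph :: "nat \<Rightarrow> (vec, vec \<times> vec) pre_digraph" where
  "lattice_graph k =
     \<lparr> verts = lattice k,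
       arcs = {(w, mult_var i w) | w i. w \<in> lattice k \<and> i \<in> {1..k}},
       tail = fst, head = snd \<rparr>"

definition strict_partitions :: "nat \<Rightarrow> vec set" where
  "strict_partitions k =
     {c \<in> lattice k.
        (\<forall>i\<in>{1..k}. 0 \<le> c i) \<and>
        (\<forall>i\<in>{1..k}. \<forall>j\<in>{1..k}. i \<le> j \<longrightarrow> c j \<le> c i) \<and>
        (\<forall>i\<in>{1..k}. \<forall>j\<in>{1..k}. i \<noteq> j \<longrightarrow> c i = c j \<longrightarrow> c i = 0)}"

definition SY :: "nat \<Rightarrow> (vec, vec \<times> vec) pre_digraph" where
  "SY k = lattice_graph k \<restriction> strict_partitions k"

text \<open>
  The lattice graph has no directed cycle (every arc increases the sum of the coordinates), so in
  its subgraphs the directed paths (no repeated vertex) are exactly the directed walks.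
\<close>

definition num_paths :: "('a, 'b) pre_digraph \<Rightarrow> 'a \<Rightarrow> 'a \<Rightarrow> nat" where
  "num_paths G v u = card {p. pre_digraph.apath G v p u}"

end

theory Submission
  imports Defs
begin

text \<open>
  Both sides satisfy the same recursion. A path that ends at a strict partition \<open>m\<close> other than
  the origin is a path to some predecessor followed by one arc (\<open>num_paths_by_last_arc\<close>), and the
  predecessors are the vectors \<open>m - e\<^sub>i\<close> that are again strict partitions (\<open>in_arcs_SY\<close>). So it is
  enough that the product formula \<open>F\<close> satisfies \<open>F(m) = \<Sum>\<^sub>i F(m - e\<^sub>i)\<close>, the sum being over these
  same \<open>i\<close> (\<open>path_formula_recursion\<close>).

  Write \<open>x\<^sub>j\<close> for the positive parts of \<open>m\<close> and \<open>y\<^sub>j = x\<^sub>j(x\<^sub>j - 1)\<close>. Lowering \<open>x\<^sub>i\<close> by one multiplies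
  the factorial quotient by \<open>x\<^sub>i/n\<close>, and it multiplies the factor for the pair of \<open>i\<close> and \<open>j\<close> by
  \<open>(x\<^sub>i - 1 - x\<^sub>j)(x\<^sub>i + x\<^sub>j) / ((x\<^sub>i - 1 + x\<^sub>j)(x\<^sub>i - x\<^sub>j)) = 1 - 2x\<^sub>j / (y\<^sub>i - y\<^sub>j)\<close>.
  If \<open>m - e\<^sub>i\<close> is not strict, then some \<open>x\<^sub>j\<close> equals \<open>x\<^sub>i - 1\<close> and this multiplier is zero, so
  the sum may as well range over all positive parts. The recursion thus amounts to
  \<open>\<Sum>\<^sub>i x\<^sub>i \<Prod>\<^bsub>j\<noteq>i\<^esub> (1 - 2x\<^sub>j / (y\<^sub>i - y\<^sub>j)) = \<Sum>\<^sub>i x\<^sub>i\<close>.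
  This is an instance of \<open>sum_of_residues\<close>, which holds for arbitrary distinct points \<open>y\<^sub>j\<close> of a
  field and arbitrary weights; the \<open>y\<^sub>j\<close> here are distinct because the parts are distinct and
  \<open>y\<^sub>i - y\<^sub>j = (x\<^sub>i - x\<^sub>j)(x\<^sub>i + x\<^sub>j - 1)\<close>.
\<close>

section \<open>A residue identity\<close>

text \<open>
  As a function of \<open>t\<close> the product tends to 1 at infinity and has simple poles at the \<open>y\<^sub>i\<close>; the
  right-hand side is its partial fraction expansion. For the induction one multiplies the expansion
  by one more factor, splits \<open>1 / ((t - y\<^sub>i)(t - y\<^sub>k))\<close> into partial fractions, and evaluates the
  induction hypothesis also at the new pole \<open>t = y\<^sub>k\<close> to identify the residue there.
\<close>

lemma partial_fraction_product:
  fixes a y :: "'i \<Rightarrow> 'a::field"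
  assumes "finite J" "inj_on y J" "t \<notin> y ` J"
  shows "(\<Prod>j\<in>J. 1 - a j / (t - y j)) =
    1 - (\<Sum>i\<in>J. a i * (\<Prod>j\<in>J - {i}. 1 - a j / (y i - y j)) / (t - y i))"
  using assms
proof (induction J arbitrary: t rule: finite_induct)
  case empty
  then show ?case by simp
next
  case (insert k J)
  define c where "c i = a i * (\<Prod>j\<in>J - {i}. 1 - a j / (y i - y j))" for i
  have yk: "y k \<notin> y ` J" and inj: "inj_on y J" and tk: "t \<noteq> y k" and tJ: "t \<notin> y ` J"
    using insert.prems insert.hyps by (auto simp: inj_on_def)
  have IHk: "(\<Prod>j\<in>J. 1 - a j / (y k - y j)) = 1 - (\<Sum>i\<in>J. c i / (y k - y i))"
    using insert.IH[OF inj yk] by (simp add: c_def)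
  have IHt: "(\<Prod>j\<in>J. 1 - a j / (t - y j)) = 1 - (\<Sum>i\<in>J. c i / (t - y i))"
    using insert.IH[OF inj tJ] by (simp add: c_def)
  have new_old: "a i * (\<Prod>j\<in>insert k J - {i}. 1 - a j / (y i - y j)) = c i * (1 - a k / (y i - y k))"
    if "i \<in> J" for i
  proof -
    have "insert k J - {i} = insert k (J - {i})" using that insert.hyps by auto
    then show ?thesis using insert.hyps by (simp add: c_def mult_ac)
  qed
  have new_k: "insert k J - {k} = J" using insert.hyps by auto
  have split: "c i * (1 - a k / (y i - y k)) / (t - y i)
      = c i / (t - y i) - a k / (t - y k) * (c i / (t - y i)) - a k / (t - y k) * (c i / (y i - y k))"
    if "i \<in> J" for i
  proof -
    have "y i \<noteq> y k" using that yk by (metis imageI)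
    then have ne: "t - y k \<noteq> 0" "t - y i \<noteq> 0" "y i - y k \<noteq> 0" using that tk tJ by auto
    have "(1 - a k / (y i - y k)) / (t - y i)
      = 1 / (t - y i) - a k / (t - y k) * (1 / (t - y i)) - a k / (t - y k) * (1 / (y i - y k))"
      using ne by (simp add: divide_simps) (simp add: algebra_simps)
    then have "c i * ((1 - a k / (y i - y k)) / (t - y i))
      = c i * (1 / (t - y i) - a k / (t - y k) * (1 / (t - y i)) - a k / (t - y k) * (1 / (y i - y k)))"
      by simp
    then show ?thesis by (simp add: algebra_simps)
  qed
  have neg: "(\<Sum>i\<in>J. c i / (y k - y i)) = - (\<Sum>i\<in>J. c i / (y i - y k))"
    unfolding sum_negf[symmetric] by (rule sum.cong) (auto simp: minus_divide_right)
  have "(\<Sum>i\<in>insert k J. a i * (\<Prod>j\<in>insert k J - {i}. 1 - a j / (y i - y j)) / (t - y i))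
      = a k * (1 - (\<Sum>i\<in>J. c i / (y k - y i))) / (t - y k)
        + (\<Sum>i\<in>J. c i * (1 - a k / (y i - y k)) / (t - y i))"
    using insert.hyps by (simp add: new_k IHk new_old cong: sum.cong)
  also have "(\<Sum>i\<in>J. c i * (1 - a k / (y i - y k)) / (t - y i))
      = (\<Sum>i\<in>J. c i / (t - y i)) - a k / (t - y k) * (\<Sum>i\<in>J. c i / (t - y i))
        - a k / (t - y k) * (\<Sum>i\<in>J. c i / (y i - y k))"
    by (simp add: split sum_subtractf sum_distrib_left cong: sum.cong)
  finally show ?case
    using insert.hyps by (simp add: IHt neg algebra_simps add_divide_distrib diff_divide_distrib)
qed

text \<open>
  Comparing the coefficients of \<open>1/t\<close> at infinity in \<open>partial_fraction_product\<close> gives this identity.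
  The induction avoids expansions at infinity: a new point \<open>y\<^sub>k\<close> adds \<open>a\<^sub>k c\<^sub>i / (y\<^sub>k - y\<^sub>i)\<close> to each old
  summand \<open>c\<^sub>i\<close>, and by the partial fraction expansion at \<open>t = y\<^sub>k\<close> the new summand is \<open>a\<^sub>k\<close> minus
  the sum of exactly these corrections.
\<close>

lemma sum_of_residues:
  fixes a y :: "'i \<Rightarrow> 'a::field"
  assumes "finite J" "inj_on y J"
  shows "(\<Sum>i\<in>J. a i * (\<Prod>j\<in>J - {i}. 1 - a j / (y i - y j))) = (\<Sum>i\<in>J. a i)"
  using assms
proof (induction J rule: finite_induct)
  case empty
  then show ?case by simp
next
  case (insert k J)
  define c where "c i = a i * (\<Prod>j\<in>J - {i}. 1 - a j / (y i - y j))" for i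
  have yk: "y k \<notin> y ` J" and inj: "inj_on y J"
    using insert.prems insert.hyps by (auto simp: inj_on_def)
  have at_k: "(\<Prod>j\<in>J. 1 - a j / (y k - y j)) = 1 - (\<Sum>i\<in>J. c i / (y k - y i))"
    using partial_fraction_product[OF insert.hyps(1) inj yk] by (simp add: c_def)
  have new_old: "a i * (\<Prod>j\<in>insert k J - {i}. 1 - a j / (y i - y j))
      = c i + a k * (c i / (y k - y i))"
    if "i \<in> J" for i
  proof -
    have eq: "insert k J - {i} = insert k (J - {i})" using that insert.hyps by auto
    have "a i * (\<Prod>j\<in>insert k J - {i}. 1 - a j / (y i - y j)) = c i * (1 - a k / (y i - y k))"
      unfolding eq using insert.hyps by (simp add: c_def mult_ac)
    also have "1 - a k / (y i - y k) = 1 + a k / (y k - y i)"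
      using minus_divide_right[of "a k" "y i - y k"] by simp
    finally show ?thesis by (simp add: algebra_simps)
  qed
  have new_k: "insert k J - {k} = J" using insert.hyps by auto
  have "(\<Sum>i\<in>insert k J. a i * (\<Prod>j\<in>insert k J - {i}. 1 - a j / (y i - y j)))
      = a k * (1 - (\<Sum>i\<in>J. c i / (y k - y i))) + (\<Sum>i\<in>J. c i + a k * (c i / (y k - y i)))"
    using insert.hyps by (simp add: new_k at_k new_old cong: sum.cong)
  also have "\<dots> = a k + (\<Sum>i\<in>J. c i)"
    by (simp add: sum.distrib sum_distrib_left algebra_simps)
  also have "(\<Sum>i\<in>J. c i) = (\<Sum>i\<in>J. a i)"
    using insert.IH[OF inj] by (simp add: c_def)
  finally show ?case using insert.hyps by simp
qed

section \<open>Counting paths by their last arc\<close>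

context wf_digraph
begin

text \<open>
  Throughout, a rank that increases along every arc expresses that the graph is acyclic.
\<close>

lemma awalk_rank_le:
  fixes rank :: "'a \<Rightarrow> 'c::order"
  assumes "\<And>e. e \<in> arcs G \<Longrightarrow> rank (tail G e) < rank (head G e)"
    and "awalk v p u" "w \<in> set (awalk_verts v p)"
  shows "rank w \<le> rank u"
  using assms(2,3)
proof (induction p arbitrary: v w)
  case Nil
  then show ?case by (simp add: awalk_Nil_iff)
next
  case (Cons e p)
  then have e: "e \<in> arcs G" "v = tail G e" "awalk (head G e) p u"
    by (auto simp: awalk_Cons_iff)
  have "rank (head G e) \<le> rank u"
    using Cons.IH[OF e(3)] e(3) by (metis hd_in_awalk_verts(1))
  then have "rank v \<le> rank u" using assms(1)[OF e(1)] e(2) by auto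
  then show ?case using Cons.prems(2) Cons.IH[OF e(3)] e(2) by auto
qed

text \<open>
  Walks, unlike paths, can be extended by any arc that starts at their end, so the equivalence
  lets the decomposition below ignore the distinctness of vertices.
\<close>

lemma apath_iff_awalk_if_ranked:
  fixes rank :: "'a \<Rightarrow> 'c::order"
  assumes rank: "\<And>e. e \<in> arcs G \<Longrightarrow> rank (tail G e) < rank (head G e)"
  shows "apath v p u \<longleftrightarrow> awalk v p u"
proof
  show "awalk v p u" if "apath v p u" using that by (rule awalkI_apath)
next
  assume "awalk v p u"
  then show "apath v p u"
  proof (induction p arbitrary: u rule: rev_induct)
    case Nil
    then show ?case by (auto simp: apath_Nil_iff awalk_Nil_iff)
  next
    case (snoc e p)
    then have e: "awalk v p (tail G e)" "e \<in> arcs G" "head G e = u"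
      by (auto simp: awalk_Cons_iff awalk_Nil_iff)
    have "head G e \<notin> set (awalk_verts v p)"
      using awalk_rank_le[OF rank e(1)] rank[OF e(2)] by (metis leD)
    moreover have "apath v p (tail G e)" by (rule snoc.IH[OF e(1)])
    ultimately show ?case
      using snoc.prems e by (auto simp: apath_def awalk_verts_append)
  qed
qed

lemma apaths_by_last_arc:
  fixes rank :: "'a \<Rightarrow> 'c::order"
  assumes rank: "\<And>e. e \<in> arcs G \<Longrightarrow> rank (tail G e) < rank (head G e)"
    and "v \<noteq> u"
  shows "{p. apath v p u} = (\<Union>e\<in>in_arcs G u. (\<lambda>p. p @ [e]) ` {p. apath v p (tail G e)})"
proof -
  have "awalk v p u \<longleftrightarrow> (\<exists>e\<in>in_arcs G u. \<exists>q. p = q @ [e] \<and> awalk v q (tail G e))" for p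
    using assms(2)
    by (cases p rule: rev_cases) (auto simp: awalk_Nil_iff awalk_Cons_iff)
  then show ?thesis by (auto simp: apath_iff_awalk_if_ranked[OF rank])
qed

text \<open>
  Finiteness of the sets of paths is needed because the number of paths is a cardinality, which
  is zero for an infinite set.
\<close>

lemma num_paths_by_last_arc:
  fixes rank :: "'a \<Rightarrow> 'c::order"
  assumes rank: "\<And>e. e \<in> arcs G \<Longrightarrow> rank (tail G e) < rank (head G e)"
    and "v \<noteq> u"
    and "finite (in_arcs G u)"
    and "\<And>e. e \<in> in_arcs G u \<Longrightarrow> finite {p. apath v p (tail G e)}"
  shows "num_paths G v u = (\<Sum>e\<in>in_arcs G u. num_paths G v (tail G e))"
proof -
  have "card (\<Union>e\<in>in_arcs G u. (\<lambda>p. p @ [e]) ` {p. apath v p (tail G e)})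
      = (\<Sum>e\<in>in_arcs G u. card ((\<lambda>p. p @ [e]) ` {p. apath v p (tail G e)}))"
    using assms(3,4) by (intro card_UN_disjoint) auto
  also have "\<dots> = (\<Sum>e\<in>in_arcs G u. num_paths G v (tail G e))"
    by (intro sum.cong) (auto simp: num_paths_def card_image inj_on_def)
  finally show ?thesis
    by (simp add: num_paths_def apaths_by_last_arc[OF rank assms(2)])
qed

lemma num_paths_self:
  assumes "v \<in> verts G"
  shows "{p. apath v p v} = {[]}" "num_paths G v v = 1"
proof -
  show "{p. apath v p v} = {[]}"
    using assms apath_nonempty_ends by (auto simp: apath_Nil_iff)
  then show "num_paths G v v = 1" by (simp add: num_paths_def)
qed

end

section \<open>The graph of strict partitions\<close>

lemma in_strict_partitionsD:
  assumes "m \<in> strict_partitions k"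
  shows "\<And>i. i \<in> {1..k} \<Longrightarrow> 0 \<le> m i"
    and "\<And>i j. i \<in> {1..k} \<Longrightarrow> j \<in> {1..k} \<Longrightarrow> i \<le> j \<Longrightarrow> m j \<le> m i"
    and "\<And>i j. i \<in> {1..k} \<Longrightarrow> j \<in> {1..k} \<Longrightarrow> i \<noteq> j \<Longrightarrow> m i = m j \<Longrightarrow> m i = 0"
  using assms by (auto simp: strict_partitions_def)

lemma wf_digraph_SY: "wf_digraph (SY k)"
  by unfold_locales (auto simp: SY_def lattice_graph_def)

lemma verts_SY: "verts (SY k) = strict_partitions k"
  by (simp add: SY_def)

lemma sum_mult_var:
  assumes "i \<in> {1..k}"
  shows "(\<Sum>l = 1..k. mult_var i w l) = (\<Sum>l = 1..k. w l) + 1"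
  using assms by (simp add: mult_var_def sum.remove[of _ i])

lemma SY_arcs_increase_sum:
  assumes "e \<in> arcs (SY k)"
  shows "(\<Sum>l = 1..k. tail (SY k) e l) < (\<Sum>l = 1..k. head (SY k) e l)"
  using assms
  by (auto simp: SY_def lattice_graph_def sum_mult_var simp del: One_nat_def)

definition box_removed :: "nat \<Rightarrow> vec \<Rightarrow> vec" where
  "box_removed i m = m(i := m i - 1)"

definition removable :: "nat \<Rightarrow> vec \<Rightarrow> nat set" where
  "removable k m = {i \<in> {1..k}. box_removed i m \<in> strict_partitions k}"

text \<open>
  An arc into \<open>m\<close> is determined by the coordinate that it increases, so a sum over arcs becomes a
  sum over removable coordinates.
\<close>

lemma in_arcs_SY:
  assumes "m \<in> strict_partitions k"
  shows "in_arcs (SY k) m = (\<lambda>i. (box_removed i m, m)) ` removable k m"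
proof -
  have 1: "box_removed i (mult_var i w) = w" "mult_var i (box_removed i w) = w" for i w
    by (simp_all add: box_removed_def mult_var_def fun_eq_iff)
  have 2: "w \<in> lattice k" if "w \<in> strict_partitions k" for w
    using that by (simp add: strict_partitions_def)
  show ?thesis
  proof (intro equalityI subsetI)
    fix e assume "e \<in> in_arcs (SY k) m"
    then show "e \<in> (\<lambda>i. (box_removed i m, m)) ` removable k m"
      by (auto simp: SY_def lattice_graph_def removable_def 1 image_iff)
  next
    fix e assume "e \<in> (\<lambda>i. (box_removed i m, m)) ` removable k m"
    then obtain i where i: "e = (box_removed i m, m)" "i \<in> {1..k}"
      "box_removed i m \<in> strict_partitions k"
      by (auto simp: removable_def)
    have "e = (box_removed i m, mult_var i (box_removed i m))" using i(1) by (simp add: 1)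
    then show "e \<in> in_arcs (SY k) m"
      using i 2 assms by (auto simp: SY_def lattice_graph_def)
  qed
qed

lemma inj_box_removed: "inj (\<lambda>i. box_removed i m)"
proof (rule injI)
  fix i j assume "box_removed i m = box_removed j m"
  then have "box_removed i m i = box_removed j m i" by simp
  then show "i = j" by (simp add: box_removed_def split: if_splits)
qed

lemma removable_pos:
  assumes "i \<in> removable k m"
  shows "m i \<ge> 1"
proof -
  have "0 \<le> box_removed i m i"
    using assms in_strict_partitionsD(1)[of "box_removed i m" k i] by (simp add: removable_def)
  then show ?thesis by (simp add: box_removed_def)
qed

text \<open>
  Since \<open>m\<close> is strict above zero, lowering a positive part keeps the order weakly decreasing. The
  only condition that can fail is strictness, when the lowered part meets another positive part.
\<close>

lemma not_removable_neighbour: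
  assumes m: "m \<in> strict_partitions k" and i: "i \<in> {1..k}" "m i \<ge> 1" "i \<notin> removable k m"
  shows "\<exists>j\<in>{1..k} - {i}. m j = m i - 1 \<and> m j \<ge> 1"
proof (rule ccontr)
  assume contra: "\<not> ?thesis"
  note D = in_strict_partitionsD[OF m]
  have smaller: "m l < m i" if "l \<in> {1..k}" "l \<noteq> i" "i \<le> l" for l
    using D(2)[OF i(1) that(1,3)] D(3)[OF i(1) that(1)] that(2) i(2) by linarith
  have "box_removed i m \<in> lattice k"
    using m i(1) by (auto simp: strict_partitions_def lattice_def box_removed_def PiE_def extensional_def)
  moreover have "0 \<le> box_removed i m l" if "l \<in> {1..k}" for l
    using D(1)[OF that] i by (simp add: box_removed_def)
  moreover have "box_removed i m l' \<le> box_removed i m l" 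
    if "l \<in> {1..k}" "l' \<in> {1..k}" "l \<le> l'" for l l'
    using D(2)[OF that] smaller[OF that(2)] that(3) by (auto simp: box_removed_def)
  moreover have "box_removed i m l = 0"
    if "l \<in> {1..k}" "l' \<in> {1..k}" "l \<noteq> l'" "box_removed i m l = box_removed i m l'" for l l'
  proof -
    consider "l = i" | "l' = i" | "l \<noteq> i" "l' \<noteq> i" by blast
    then show ?thesis
    proof cases
      case 1
      then show ?thesis using that contra D(1)[of l'] by (force simp: box_removed_def)
    next
      case 2
      then show ?thesis using that contra D(1)[of l] by (force simp: box_removed_def)
    next
      case 3
      then show ?thesis using that D(3)[of l l'] by (simp add: box_removed_def)
    qed
  qed
  ultimately show False
    using i by (auto simp: removable_def strict_partitions_def)
qed

lemma finite_removable: "finite (removable k m)"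
  by (simp add: removable_def)

section \<open>The product formula obeys the same recursion\<close>

definition pair_factor :: "int \<Rightarrow> int \<Rightarrow> real" where
  "pair_factor a b = (if a = 0 \<and> b = 0 then 1 else real_of_int (a - b) / real_of_int (a + b))"

definition index_pairs :: "nat \<Rightarrow> (nat \<times> nat) set" where
  "index_pairs k = {(i, j). 1 \<le> i \<and> i < j \<and> j \<le> k}"

definition path_formula :: "nat \<Rightarrow> vec \<Rightarrow> real" where
  "path_formula k m = (\<Prod>(i, j)\<in>index_pairs k. pair_factor (m i) (m j))
    * (fact (nat (\<Sum>i = 1..k. m i)) / (\<Prod>i = 1..k. fact (nat (m i))))"

text \<open>
  The multiplier of \<open>(a - b) / (a + b)\<close> when \<open>a\<close> decreases by one, written with \<open>a(a - 1)\<close> and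
  \<open>b(b - 1)\<close> so that products of it have the form in \<open>sum_of_residues\<close>.
\<close>

definition factor_change :: "int \<Rightarrow> int \<Rightarrow> real" where
  "factor_change a b = 1 - 2 * of_int b / (of_int (a * (a - 1)) - of_int (b * (b - 1)))"

text \<open>
  For \<open>b > 0\<close> this is \<open>(a - 1 - b)(a + b) = a(a - 1) - b(b + 1)\<close> together with
  \<open>(a - 1 + b)(a - b) = a(a - 1) - b(b - 1)\<close>. For \<open>b = 0\<close> all three quantities are 1, including
  the case \<open>a = 1\<close>, where \<open>pair_factor\<close> takes its conventional value.
\<close>

lemma pair_factor_decrease_left:
  assumes "a \<ge> 1" "b \<ge> 0" "a \<noteq> b"
  shows "pair_factor (a - 1) b = pair_factor a b * factor_change a b"
proof (cases "b = 0")
  case True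
  then show ?thesis using assms by (simp add: pair_factor_def factor_change_def)
next
  case False
  define x y where "x = real_of_int a" and "y = real_of_int b"
  have ne: "x - y \<noteq> 0" "x - 1 + y \<noteq> 0" "x + y \<noteq> 0"
    using assms False unfolding x_def y_def by linarith+
  have y: "x * (x - 1) - y * (y - 1) = (x - y) * (x - 1 + y)" by (simp add: algebra_simps)
  have "(x - 1 - y) / (x - 1 + y) = (x - y) / (x + y) * (1 - 2 * y / (x * (x - 1) - y * (y - 1)))"
    unfolding y using ne by (simp add: divide_simps) (simp add: algebra_simps)
  then show ?thesis
    using assms False by (simp add: pair_factor_def factor_change_def x_def y_def)
qed

text \<open>
  Here \<open>b\<close> must be positive: \<open>pair_factor 0 1 = - 1\<close>, while \<open>pair_factor 0 0 = 1\<close> and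
  \<open>factor_change 1 0 = 1\<close>. For \<open>b > 0\<close> the claim follows from the antisymmetry of the quotient.
\<close>

lemma pair_factor_decrease_right:
  assumes "a \<ge> 1" "b \<ge> 1" "a \<noteq> b"
  shows "pair_factor b (a - 1) = pair_factor b a * factor_change a b"
proof -
  have swap: "pair_factor b c = - pair_factor c b" for c
    using assms minus_divide_left[of "real_of_int (c - b)" "real_of_int (c + b)"]
    by (simp add: pair_factor_def add.commute)
  show ?thesis
    using pair_factor_decrease_left[of a b] assms unfolding swap[of a] swap[of "a - 1"] by simp
qed

lemma finite_index_pairs: "finite (index_pairs k)"
  by (rule finite_subset[of _ "{1..k} \<times> {1..k}"]) (auto simp: index_pairs_def)

text \<open>
  The pairs that contain \<open>i\<close>, in either position, correspond to the indices other than \<open>i\<close>.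
\<close>

lemma prod_pairs_through:
  fixes R :: "nat \<Rightarrow> 'a::comm_monoid_mult"
  assumes i: "i \<in> {1..k}"
  shows "(\<Prod>(p, q)\<in>index_pairs k. if p = i then R q else if q = i then R p else 1)
    = (\<Prod>j\<in>{1..k} - {i}. R j)"
proof -
  have "(\<Prod>(p, q)\<in>index_pairs k. if p = i then R q else if q = i then R p else 1)
    = (\<Prod>(p, q)\<in>{(p, q) \<in> index_pairs k. p = i \<or> q = i}.
        if p = i then R q else if q = i then R p else 1)"
    by (rule prod.mono_neutral_right) (auto simp: finite_index_pairs split: if_splits)
  also have "\<dots> = (\<Prod>j\<in>{1..k} - {i}. R j)"
    using i by (intro prod.reindex_bij_witness[where
      j = "\<lambda>(p, q). if p = i then q else p" and
      i = "\<lambda>j. if i < j then (i, j) else (j, i)"])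
      (auto simp: index_pairs_def split: if_splits)
  finally show ?thesis .
qed

lemma pair_product_decrease:
  assumes m: "m \<in> strict_partitions k" and i: "i \<in> {1..k}" "m i \<ge> 1"
  shows "(\<Prod>(p, q)\<in>index_pairs k. pair_factor (box_removed i m p) (box_removed i m q))
    = (\<Prod>(p, q)\<in>index_pairs k. pair_factor (m p) (m q))
      * (\<Prod>j\<in>{1..k} - {i}. factor_change (m i) (m j))"
proof -
  note D = in_strict_partitionsD[OF m]
  have ne: "m i \<noteq> m j" if "j \<in> {1..k}" "j \<noteq> i" for j
    using D(3)[OF i(1) that(1)] that i by auto
  have change: "pair_factor (box_removed i m p) (box_removed i m q) = pair_factor (m p) (m q) *
      (if p = i then factor_change (m i) (m q)
       else if q = i then factor_change (m i) (m p) else 1)"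
    if pq: "p \<in> {1..k}" "q \<in> {1..k}" "p < q" for p q
  proof -
    consider "p = i" "q \<noteq> i" | "q = i" "p \<noteq> i" | "p \<noteq> i" "q \<noteq> i" using pq by blast
    then show ?thesis
    proof cases
      case 1
      then show ?thesis
        using pair_factor_decrease_left[OF i(2) D(1)[OF pq(2)] ne[OF pq(2)]]
        by (simp add: box_removed_def)
    next
      case 2
      then have "m p \<ge> 1" using D(2)[OF pq(1,2)] pq(3) i(2) by simp
      then show ?thesis
        using 2 pair_factor_decrease_right[OF i(2) _ ne[OF pq(1)]]
        by (simp add: box_removed_def)
    next
      case 3
      then show ?thesis by (simp add: box_removed_def)
    qed
  qed
  have "(\<Prod>(p, q)\<in>index_pairs k. pair_factor (box_removed i m p) (box_removed i m q))
    = (\<Prod>(p, q)\<in>index_pairs k. pair_factor (m p) (m q) *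
        (if p = i then factor_change (m i) (m q)
         else if q = i then factor_change (m i) (m p) else 1))"
    using change by (intro prod.cong) (auto simp: index_pairs_def)
  then show ?thesis
    by (simp add: case_prod_beta prod.distrib
        prod_pairs_through[OF i(1), of "\<lambda>j. factor_change (m i) (m j)", unfolded case_prod_beta]
        del: One_nat_def)
qed

lemma factorial_quotient_decrease:
  assumes nonneg: "\<forall>l\<in>{1..k}. m l \<ge> 0" and i: "i \<in> {1..k}" "m i \<ge> 1"
  shows "fact (nat (\<Sum>l = 1..k. box_removed i m l)) / (\<Prod>l = 1..k. fact (nat (box_removed i m l)))
    = (fact (nat (\<Sum>l = 1..k. m l)) / (\<Prod>l = 1..k. fact (nat (m l))) :: real)
      * (of_int (m i) / of_int (\<Sum>l = 1..k. m l))"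
proof -
  have fact_nat: "fact (nat a) = of_int a * (fact (nat (a - 1)) :: real)" if "a \<ge> 1" for a
    using that by (subst fact_reduce) (auto simp: nat_diff_distrib)
  define n where "n = (\<Sum>l = 1..k. m l)"
  have "m i \<le> n" unfolding n_def using nonneg i by (intro member_le_sum) auto
  then have n: "n \<ge> 1" using i by simp
  have sum: "(\<Sum>l = 1..k. box_removed i m l) = n - 1"
    using i(1) by (simp add: n_def box_removed_def sum.remove[of _ i])
  have "(\<Prod>l = 1..k. fact (nat (m l))) = fact (nat (m i)) * (\<Prod>l\<in>{1..k} - {i}. fact (nat (m l)) :: real)"
    using i(1) by (simp add: prod.remove[of _ i])
  also have "\<dots> = of_int (m i) * (fact (nat (m i - 1)) * (\<Prod>l\<in>{1..k} - {i}. fact (nat (m l))))"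
    using fact_nat[OF i(2)] by simp
  also have "fact (nat (m i - 1)) * (\<Prod>l\<in>{1..k} - {i}. fact (nat (m l)) :: real)
      = (\<Prod>l = 1..k. fact (nat (box_removed i m l)))"
    using i(1) by (simp add: box_removed_def prod.remove[of _ i])
  finally have prod: "(\<Prod>l = 1..k. fact (nat (m l)) :: real)
      = of_int (m i) * (\<Prod>l = 1..k. fact (nat (box_removed i m l)))" .
  show ?thesis
    unfolding n_def[symmetric] sum prod fact_nat[OF n] using i n by simp
qed

lemma path_formula_decrease:
  assumes m: "m \<in> strict_partitions k" and i: "i \<in> {1..k}" "m i \<ge> 1"
  shows "path_formula k (box_removed i m) = path_formula k m / of_int (\<Sum>l = 1..k. m l)
    * (of_int (m i) * (\<Prod>j\<in>{1..k} - {i}. factor_change (m i) (m j)))"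
proof -
  have "\<forall>l\<in>{1..k}. m l \<ge> 0" using in_strict_partitionsD(1)[OF m] by blast
  note quotient = factorial_quotient_decrease[OF this i]
  show ?thesis
    unfolding path_formula_def pair_product_decrease[OF assms] quotient by simp
qed

lemma factor_change_zero: "factor_change a 0 = 1"
  by (simp add: factor_change_def)

lemma factor_change_predecessor:
  assumes "a \<ge> 2"
  shows "factor_change a (a - 1) = 0"
proof -
  have "real_of_int (a * (a - 1)) - of_int ((a - 1) * (a - 1 - 1)) = 2 * of_int (a - 1)"
    by (simp add: algebra_simps)
  then show ?thesis using assms by (simp add: factor_change_def del: of_int_mult of_int_diff)
qed

text \<open>
  By \<open>path_formula_decrease\<close> the summands on the right are \<open>path_formula k m / n\<close> times weights
  \<open>w i\<close>. The weights vanish at the positive parts that cannot be lowered, and by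
  \<open>sum_of_residues\<close>, applied to all positive parts with \<open>a\<^sub>j = 2 m\<^sub>j\<close>, they add up to \<open>n\<close>.
\<close>

lemma path_formula_recursion:
  assumes m: "m \<in> strict_partitions k" and pos: "(\<Sum>l = 1..k. m l) > 0"
  shows "path_formula k m = (\<Sum>i\<in>removable k m. path_formula k (box_removed i m))"
proof -
  note D = in_strict_partitionsD[OF m]
  define n where "n = (\<Sum>l = 1..k. m l)"
  define J where "J = {i \<in> {1..k}. m i \<ge> 1}"
  define y where "y j = real_of_int (m j * (m j - 1))" for j
  define w where "w i = real_of_int (m i) * (\<Prod>j\<in>{1..k} - {i}. factor_change (m i) (m j))" for i
  have finJ: "finite J" by (simp add: J_def)
  have inj: "inj_on y J"
  proof (rule inj_onI)
    fix i j assume ij: "i \<in> J" "j \<in> J" "y i = y j"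
    then have "m i * (m i - 1) = m j * (m j - 1)" unfolding y_def by linarith
    then have "(m i - m j) * (m i + m j - 1) = 0" by (simp add: algebra_simps)
    then have "m i = m j" using ij by (auto simp: J_def)
    then show "i = j" using D(3)[of i j] ij by (auto simp: J_def)
  qed
  \<comment> \<open>Zero parts contribute only multipliers equal to 1, and are left out because several of them
    would share the value \<open>y = 0\<close>.\<close>
  have w_J: "w i = of_int (m i) * (\<Prod>j\<in>J - {i}. 1 - 2 * of_int (m j) / (y i - y j))" 
    if "i \<in> J" for i
  proof -
    have "(\<Prod>j\<in>{1..k} - {i}. factor_change (m i) (m j)) = (\<Prod>j\<in>J - {i}. factor_change (m i) (m j))"
    proof (rule prod.mono_neutral_right)
      show "\<forall>j\<in>{1..k} - {i} - (J - {i}). factor_change (m i) (m j) = 1"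
      proof
        fix j assume j: "j \<in> {1..k} - {i} - (J - {i})"
        then have "m j = 0" using D(1)[of j] by (auto simp: J_def)
        then show "factor_change (m i) (m j) = 1" by (simp add: factor_change_zero)
      qed
    qed (auto simp: J_def)
    then show ?thesis by (simp add: w_def factor_change_def y_def)
  qed
  have "2 * (\<Sum>i\<in>J. w i)
      = (\<Sum>i\<in>J. 2 * of_int (m i) * (\<Prod>j\<in>J - {i}. 1 - 2 * of_int (m j) / (y i - y j)))"
    by (simp add: sum_distrib_left w_J mult.assoc cong: sum.cong)
  also have "\<dots> = 2 * (\<Sum>i\<in>J. of_int (m i))"
    using sum_of_residues[OF finJ inj, of "\<lambda>j. 2 * of_int (m j)"] by (simp add: sum_distrib_left)
  also have "(\<Sum>i\<in>J. of_int (m i)) = real_of_int n"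
  proof -
    have "(\<Sum>i = 1..k. m i) = (\<Sum>i\<in>J. m i)"
    proof (rule sum.mono_neutral_right)
      show "\<forall>i\<in>{1..k} - J. m i = 0" using D(1) by (force simp: J_def)
    qed (auto simp: J_def)
    then show ?thesis by (simp add: n_def)
  qed
  finally have sum_w: "(\<Sum>i\<in>J. w i) = of_int n" by simp
  have w_zero: "w i = 0" if i: "i \<in> J - removable k m" for i
  proof -
    have i': "i \<in> {1..k}" "m i \<ge> 1" "i \<notin> removable k m" using i by (auto simp: J_def)
    obtain j where j: "j \<in> {1..k} - {i}" "m j = m i - 1" "m j \<ge> 1"
      using not_removable_neighbour[OF m i'] by blast
    have "factor_change (m i) (m j) = 0"
      using j factor_change_predecessor[of "m i"] by simp
    then have "(\<Prod>j\<in>{1..k} - {i}. factor_change (m i) (m j)) = 0"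
      using j(1) by (intro prod_zero) auto
    then show ?thesis by (simp add: w_def)
  qed
  have sub: "removable k m \<subseteq> J"
    using removable_pos by (auto simp: J_def removable_def)
  have "(\<Sum>i\<in>removable k m. path_formula k (box_removed i m))
      = (\<Sum>i\<in>removable k m. path_formula k m / of_int n * w i)"
    using sub unfolding n_def w_def
    by (intro sum.cong refl path_formula_decrease[OF m]) (auto simp: J_def)
  also have "\<dots> = path_formula k m / of_int n * (\<Sum>i\<in>removable k m. w i)"
    by (simp add: sum_distrib_left)
  also have "(\<Sum>i\<in>removable k m. w i) = (\<Sum>i\<in>J. w i)"
    using finJ sub w_zero by (intro sum.mono_neutral_left) auto
  finally show ?thesis using pos by (simp add: sum_w n_def del: of_int_sum)
qed

section \<open>The number of paths\<close>

lemma origin_strict_partition: "origin k \<in> strict_partitions k"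
  by (auto simp: strict_partitions_def origin_def lattice_def)

lemma path_formula_origin: "path_formula k (origin k) = 1"
proof -
  have "(\<Prod>(i, j)\<in>index_pairs k. pair_factor (origin k i) (origin k j)) = 1"
    by (rule prod.neutral) (auto simp: index_pairs_def origin_def pair_factor_def)
  then show ?thesis by (simp add: path_formula_def origin_def)
qed

lemma strict_partition_sum_pos:
  assumes m: "m \<in> strict_partitions k" and "m \<noteq> origin k"
  shows "(\<Sum>l = 1..k. m l) > 0"
proof -
  have ext: "m \<in> extensional {1..k}"
    using m by (simp add: strict_partitions_def lattice_def PiE_def)
  have "\<exists>l\<in>{1..k}. m l \<noteq> 0"
  proof (rule ccontr)
    assume "\<not> ?thesis"
    then have "m = origin k"
      using ext by (auto simp: origin_def extensional_def fun_eq_iff restrict_def)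
    then show False using assms by simp
  qed
  then obtain l where l: "l \<in> {1..k}" "m l \<noteq> 0" by blast
  then have "m l > 0" using in_strict_partitionsD(1)[OF m l(1)] by simp
  then show ?thesis
    using l in_strict_partitionsD(1)[OF m] by (intro sum_pos2[of _ l]) auto
qed

text \<open>
  Finiteness is carried through the induction because \<open>num_paths_by_last_arc\<close> requires it for the
  predecessors.
\<close>

lemma num_paths_SY:
  assumes "m \<in> strict_partitions k"
  shows "finite {p. pre_digraph.apath (SY k) (origin k) p m} \<and>
    real (num_paths (SY k) (origin k) m) = path_formula k m"
  using assms
proof (induction "nat (\<Sum>l = 1..k. m l)" arbitrary: m rule: less_induct)
  case less
  interpret wf_digraph "SY k" by (rule wf_digraph_SY)
  show ?case
  proof (cases "m = origin k")
    case True
    then show ?thesis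
      using num_paths_self[of "origin k"] origin_strict_partition
      by (simp add: verts_SY path_formula_origin)
  next
    case False
    note arcs = in_arcs_SY[OF less.prems]
    note by_last_arc = apaths_by_last_arc[where rank = "\<lambda>w. \<Sum>l = 1..k. w l"]
      num_paths_by_last_arc[where rank = "\<lambda>w. \<Sum>l = 1..k. w l"]
    have pos: "(\<Sum>l = 1..k. m l) > 0"
      using strict_partition_sum_pos less.prems False by blast
    have IH: "finite {p. apath (origin k) p (box_removed i m)}"
      "real (num_paths (SY k) (origin k) (box_removed i m)) = path_formula k (box_removed i m)"
      if i: "i \<in> removable k m" for i
    proof -
      have "(\<Sum>l = 1..k. box_removed i m l) = (\<Sum>l = 1..k. m l) - 1"
        using i by (simp add: removable_def box_removed_def sum.remove[of _ i])
      moreover have "box_removed i m \<in> strict_partitions k" using i by (simp add: removable_def)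
      ultimately show "finite {p. apath (origin k) p (box_removed i m)}"
        "real (num_paths (SY k) (origin k) (box_removed i m)) = path_formula k (box_removed i m)"
        using less.hyps[of "box_removed i m"] pos by auto
    qed
    have tail: "tail (SY k) = fst" by (simp add: SY_def lattice_graph_def)
    have fin_in: "finite (in_arcs (SY k) m)" by (simp add: arcs finite_removable)
    have fin: "finite {p. apath (origin k) p (tail (SY k) e)}" if "e \<in> in_arcs (SY k) m" for e
      using that IH(1) unfolding arcs by (auto simp: tail)
    have "{p. apath (origin k) p m} = (\<Union>e\<in>in_arcs (SY k) m.
        (\<lambda>p. p @ [e]) ` {p. apath (origin k) p (tail (SY k) e)})"
      using False by (intro by_last_arc(1) SY_arcs_increase_sum) auto
    then have "finite {p. apath (origin k) p m}"
      using fin_in fin by simp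
    moreover have "num_paths (SY k) (origin k) m
        = (\<Sum>e\<in>in_arcs (SY k) m. num_paths (SY k) (origin k) (tail (SY k) e))"
      using fin_in fin False by (intro by_last_arc(2) SY_arcs_increase_sum) auto
    moreover have "\<dots> = (\<Sum>i\<in>removable k m. num_paths (SY k) (origin k) (box_removed i m))"
      unfolding arcs tail
      using inj_box_removed by (subst sum.reindex) (auto simp: inj_on_def inj_def)
    ultimately show ?thesis
      using IH(2) path_formula_recursion[OF less.prems pos] by simp
  qed
qed

theorem corollary4:
  fixes k :: nat and m :: vec
  assumes "k \<ge> 1"
    and "m \<in> verts (SY k)"
  shows "real (num_paths (SY k) (origin k) m) =
    (\<Prod>(i, j)\<in>{(i, j). 1 \<le> i \<and> i < j \<and> j \<le> k}.
        if m i = 0 \<and> m j = 0 then 1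
        else real_of_int (m i - m j) / real_of_int (m i + m j))
    * (fact (nat (\<Sum>i = 1..k. m i)) / (\<Prod>i = 1..k. fact (nat (m i))))"
  using num_paths_SY[of m k] assms(2)
  by (simp add: verts_SY path_formula_def index_pairs_def pair_factor_def)

end
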